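(* For each positive integer $g$, let $N(g)$ be the number of numerical semigroups of genus $g$, and let $Q(g)$ be the number of numerical semigroups $S$ of genus $g$ with $F(S)<2m(S)$ and $W(S) < g-1$. Then \[\lim_{g\to \infty} \frac{Q(g)}{N(g)} = 0.\]
   Context: A numerical semigroup $S$ is an additive submonoid of $\mathbb{N}=\{0,1,2,\ldots\}$ (containing $0$) such that $\mathbb{N}\setminus S$ is finite. The elements of $\mathbb{N}\setminus S$ are the gaps of $S$; the number of gaps is the genus $g$ of $S$, the largest gap is the Frobenius number $F(S)$, and the smallest nonzero element of $S$ is the multiplicity $m(S)$. If $S$ has genus $g$ and gap set $\{a_1,\ldots,a_g\}$, the weight of $S$ is $W(S)=\sum_{i=1}^g a_i - \frac{g(g+1)}{2}$. *)

theory Defs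
  imports Complex_Main
begin

definition numerical_semigroup :: "nat set \<Rightarrow> bool" where
  "numerical_semigroup S \<longleftrightarrow>
     0 \<in> S \<and> (\<forall>x\<in>S. \<forall>y\<in>S. x + y \<in> S) \<and> finite (UNIV - S)"

definition gaps :: "nat set \<Rightarrow> nat set" where
  "gaps S = UNIV - S"

definition genus :: "nat set \<Rightarrow> nat" where
  "genus S = card (gaps S)"

(* Unspecified for S = UNIV, the only numerical semigroup of genus 0. *)
definition frobenius_number :: "nat set \<Rightarrow> nat" where
  "frobenius_number S = Max (gaps S)"

definition semigroup_multiplicity :: "nat set \<Rightarrow> nat" where
  "semigroup_multiplicity S = (LEAST n. n \<in> S \<and> n \<noteq> 0)"

(* Integer-valued, so that the subtraction is not truncated; the division by 2 is exact. *)
definition weight :: "nat set \<Rightarrow> int" where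
  "weight S = (\<Sum>a\<in>gaps S. int a) - int (genus S) * (int (genus S) + 1) div 2"

definition semigroups_of_genus :: "nat \<Rightarrow> nat set set" where
  "semigroups_of_genus g = {S. numerical_semigroup S \<and> genus S = g}"

definition N :: "nat \<Rightarrow> nat" where
  "N g = card (semigroups_of_genus g)"

definition Q :: "nat \<Rightarrow> nat" where
  "Q g = card {S \<in> semigroups_of_genus g.
     frobenius_number S < 2 * semigroup_multiplicity S \<and> weight S < int g - 1}"

end

theory Submission
  imports Defs "HOL-Number_Theory.Fib" "HOL-Real_Asymp.Real_Asymp"
begin

text \<open>
  A semigroup of genus \<open>g\<close> with multiplicity \<open>m = p + 1\<close> and \<open>F < 2m\<close> has the gaps
  \<open>1, \<dots>, p\<close> and \<open>m + b\<close> for \<open>b\<close> in an arbitrary set \<open>B \<subseteq> {1..p}\<close> with \<open>k = g - p\<close> elements,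
  and its weight is \<open>k + (\<Sum>B - k(k+1)/2)\<close>.
  Counting all such sets gives a Fibonacci number as a lower bound for \<open>N g\<close>. On the other hand
  \<open>\<Sum>B - k(k+1)/2\<close> is the size of a partition, and partitions grow subexponentially: weighting
  by \<open>x\<^bsup>\<Sum>B\<^esup>\<close> gives a Gaussian binomial coefficient, bounded for fixed \<open>x < 1\<close> by
  \<open>\<Prod> 1/(1 - x\<^sup>i)\<close>, whence \<open>Q g = O(g x\<^bsup>-g\<^esup>)\<close>. Any \<open>x\<close> with \<open>1/x\<close> below the golden ratio
  suffices, and we take \<open>x = 2/3\<close>.
\<close>

section \<open>Subsets of given size weighted by their sum\<close>

lemma subsets_card_Suc:
  "{B. B \<subseteq> {1..Suc n} \<and> card B = Suc k} =
     {B. B \<subseteq> {1..n} \<and> card B = Suc k} \<union> insert (Suc n) ` {B. B \<subseteq> {1..n} \<and> card B = k}"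
  (is "?L = ?R1 \<union> ?R2")
proof (intro equalityI subsetI)
  fix B assume B: "B \<in> ?L"
  then have fin: "finite B" using finite_subset by blast
  show "B \<in> ?R1 \<union> ?R2"
  proof (cases "Suc n \<in> B")
    case True
    then have "B = insert (Suc n) (B - {Suc n})" "card (B - {Suc n}) = k"
      using B fin by auto
    moreover have "B - {Suc n} \<subseteq> {1..n}" using B by force
    ultimately show ?thesis by blast
  next
    case False
    then show ?thesis using B by (auto simp: subset_iff le_Suc_eq)
  qed
next
  fix B assume "B \<in> ?R1 \<union> ?R2"
  then show "B \<in> ?L"
  proof
    assume "B \<in> ?R2"
    then obtain A where A: "A \<subseteq> {1..n}" "card A = k" "B = insert (Suc n) A" by blast
    then have "finite A" "Suc n \<notin> A" using finite_subset by auto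
    with A show ?thesis by auto
  qed auto
qed

text \<open>Splitting by whether \<open>Suc n\<close> lies in \<open>B\<close> gives the Pascal
  recurrence of Gaussian binomials, here with the factor x^(k(k+1)/2) still inside the sum.\<close>

lemma sum_pow_subsets_Suc:
  fixes x :: "'a::comm_semiring_1"
  shows "(\<Sum>B | B \<subseteq> {1..Suc n} \<and> card B = Suc k. x ^ \<Sum>B) =
     (\<Sum>B | B \<subseteq> {1..n} \<and> card B = Suc k. x ^ \<Sum>B) +
     x ^ Suc n * (\<Sum>B | B \<subseteq> {1..n} \<and> card B = k. x ^ \<Sum>B)"
proof -
  let ?A = "\<lambda>k. {B. B \<subseteq> {1..n} \<and> card B = k}"
  have fin: "finite (?A j)" for j by (rule finite_subset[of _ "Pow {1..n}"]) auto
  have disj: "?A (Suc k) \<inter> insert (Suc n) ` ?A k = {}" by auto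
  have nin: "Suc n \<notin> B" "finite B" if "B \<in> ?A k" for B
    using that finite_subset by auto
  have inj: "inj_on (insert (Suc n)) (?A k)"
    using nin(1) by (intro inj_onI) (metis insert_ident)
  have "(\<Sum>B\<in>insert (Suc n) ` ?A k. x ^ \<Sum>B) = (\<Sum>B\<in>?A k. x ^ Suc n * x ^ \<Sum>B)"
    unfolding sum.reindex[OF inj] o_def
  proof (rule sum.cong[OF refl])
    fix B assume "B \<in> ?A k"
    from nin[OF this] have "\<Sum>(insert (Suc n) B) = Suc n + \<Sum>B" by simp
    then show "x ^ \<Sum>(insert (Suc n) B) = x ^ Suc n * x ^ \<Sum>B" by (simp only: power_add)
  qed
  then show ?thesis
    unfolding subsets_card_Suc sum.union_disjoint[OF fin finite_imageI[OF fin] disj]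
    by (simp add: sum_distrib_left)
qed

text \<open>The sum is x^(1+...+k) times the Gaussian binomial, the product of (1 - x^(k+i)) / (1 -
  x^i) over i = 1..n-k, whose numerators are at most 1. The induction reaches the bound through the
  recurrence alone, without this closed form.\<close>

lemma sum_pow_subsets_le:
  fixes x :: real
  assumes x: "0 < x" "x < 1"
  shows "(\<Sum>B | B \<subseteq> {1..n} \<and> card B = k. x ^ \<Sum>B)
           \<le> x ^ \<Sum>{..k} * (\<Prod>i=1..n - k. 1 / (1 - x ^ i))"
proof (induction n arbitrary: k)
  case 0
  have *: "{B. B \<subseteq> {1..0::nat} \<and> card B = k} = (if k = 0 then {{}} else {})" by auto
  show ?case unfolding * using x by simp
next
  case (Suc n)
  let ?H = "\<lambda>n k. \<Sum>B | B \<subseteq> {1..n} \<and> card B = k. x ^ \<Sum>B"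
  let ?P = "\<lambda>n. \<Prod>i=1..n. 1 / (1 - x ^ i)"
  have lt1: "x ^ i < 1" if "i \<ge> 1" for i
    using x that by (simp add: power_less_one_iff)
  show ?case
  proof (cases k)
    case 0
    have "{B. B \<subseteq> {1..Suc n} \<and> card B = 0} = {{}}"
      using finite_subset by fastforce
    moreover have "1 \<le> ?P (Suc n)"
      using lt1 x by (intro prod_ge_1) (simp add: field_simps)
    ultimately show ?thesis using 0 by simp
  next
    case k: (Suc j)
    have zero: "?H m i = 0" if "m < i" for m i
    proof -
      have "card B \<noteq> i" if "B \<subseteq> {1..m}" for B
        using card_mono[OF _ that] \<open>m < i\<close> by simp
      then have *: "{B. B \<subseteq> {1..m} \<and> card B = i} = {}" by blast
      show ?thesis unfolding * by simp
    qed
    \<comment> \<open>No subset, only the full set, or the generic case. Only in the last is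
      \<open>n - k\<close> free of truncation once \<open>j\<close> is replaced by
      \<open>k\<close>.\<close>
    consider "n < j" | "j = n" | "j < n" by linarith
    then show ?thesis
    proof cases
      case 1
      then show ?thesis using zero[of "Suc n" k] k x by simp
    next
      case 2
      have "?H (Suc n) k = x ^ Suc n * ?H n n"
        using sum_pow_subsets_Suc[of x n j] zero[of n k] k 2 by simp
      also have "\<dots> \<le> x ^ Suc n * (x ^ \<Sum>{..n} * ?P (n - n))"
        using Suc.IH[of n] x by (intro mult_left_mono) auto
      also have "\<dots> = x ^ \<Sum>{..k} * ?P (Suc n - k)"
        using k 2 by (simp add: power_add mult_ac)
      finally show ?thesis .
    next
      case 3
      then obtain d where d: "n = j + Suc d" using less_imp_Suc_add by auto
      have ne: "1 - x ^ Suc d \<noteq> 0" using lt1[of "Suc d"] by simp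
      \<comment> \<open>The last factor of the product telescopes, so the bound satisfies the
        recurrence with equality. The powers match because \<open>Suc n = k + Suc d\<close>.\<close>
      have "c + b * a = a" if "a * (1 - b) = c" for a b c :: real
        using that by (auto simp: algebra_simps)
      moreover have "?P (Suc d) * (1 - x ^ Suc d) = ?P d"
        using ne by simp
      ultimately have P: "?P d + x ^ Suc d * ?P (Suc d) = ?P (Suc d)" .
      have sub: "Suc n - k = Suc d" using d k by simp
      have "?H (Suc n) k = ?H n k + x ^ Suc n * ?H n j"
        using sum_pow_subsets_Suc[of x n j] k by simp
      also have "\<dots> \<le> x ^ \<Sum>{..k} * ?P (n - k) + x ^ Suc n * (x ^ \<Sum>{..j} * ?P (n - j))"
        using Suc.IH[of j] Suc.IH[of k] x by (intro add_mono mult_left_mono) auto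
      also have "\<dots> = x ^ \<Sum>{..k} * ?P d + x ^ \<Sum>{..k} * x ^ Suc d * ?P (Suc d)"
        using d k by (simp add: power_add mult_ac)
      also have "\<dots> = x ^ \<Sum>{..k} * ?P (Suc n - k)"
        unfolding sub by (simp only: mult.assoc P flip: distrib_left)
      finally show ?thesis .
    qed
  qed
qed

text \<open>Each factor is 1 + x^i / (1 - x^i) \<le> exp (x^i / (1 - x)), and the exponents sum to
  at most a geometric series. The bound does not depend on \<open>n\<close>.\<close>

lemma prod_inverse_one_minus_pow_le:
  fixes x :: real
  assumes x: "0 < x" "x < 1"
  shows "(\<Prod>i=1..n. 1 / (1 - x ^ i)) \<le> exp (1 / (1 - x)\<^sup>2)"
proof -
  have "(\<Prod>i=1..n. 1 / (1 - x ^ i)) \<le> (\<Prod>i=1..n. exp (x ^ i / (1 - x)))"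
  proof (rule prod_mono)
    fix i assume i: "i \<in> {1..n}"
    have le: "x ^ i \<le> x" using power_decreasing[of 1 i x] i x by simp
    have "1 / (1 - x ^ i) = 1 + x ^ i / (1 - x ^ i)"
      using le x by (simp add: field_simps)
    also have "\<dots> \<le> 1 + x ^ i / (1 - x)"
      using le x by (intro add_left_mono divide_left_mono) auto
    also have "\<dots> \<le> exp (x ^ i / (1 - x))" by (rule exp_ge_add_one_self)
    finally show "0 \<le> 1 / (1 - x ^ i) \<and> 1 / (1 - x ^ i) \<le> exp (x ^ i / (1 - x))"
      using le x by simp
  qed
  also have "\<dots> = exp ((\<Sum>i=1..n. x ^ i) / (1 - x))"
    by (simp add: exp_sum sum_divide_distrib)
  also have "(\<Sum>i=1..n. x ^ i) \<le> (\<Sum>i. x ^ i)"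
    using x by (intro sum_le_suminf summable_geometric) auto
  also have "(\<Sum>i. x ^ i) = 1 / (1 - x)" using x by (intro suminf_geometric) auto
  finally show ?thesis using x by (simp add: power2_eq_square divide_right_mono)
qed

text \<open>Rankin's trick: every counted \<open>B\<close> contributes at least x^(1+...+k+g) to the
  weighted sum. The factor x^(1+...+k) cancels, so the bound is uniform in \<open>n\<close> and
  \<open>k\<close>.\<close>

lemma card_subsets_small_sum_le:
  fixes x :: real
  assumes x: "0 < x" "x < 1"
  shows "real (card {B. B \<subseteq> {1..n} \<and> card B = k \<and> \<Sum>B \<le> \<Sum>{..k} + g})
           \<le> exp (1 / (1 - x)\<^sup>2) / x ^ g"
proof -
  let ?A = "{B. B \<subseteq> {1..n} \<and> card B = k \<and> \<Sum>B \<le> \<Sum>{..k} + g}"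
  have "real (card ?A) * (x ^ \<Sum>{..k} * x ^ g) = (\<Sum>B\<in>?A. x ^ (\<Sum>{..k} + g))"
    by (simp add: power_add)
  also have "\<dots> \<le> (\<Sum>B\<in>?A. x ^ \<Sum>B)"
    using x by (intro sum_mono power_decreasing) auto
  also have "\<dots> \<le> (\<Sum>B | B \<subseteq> {1..n} \<and> card B = k. x ^ \<Sum>B)"
  proof (rule sum_mono2)
    show "finite {B. B \<subseteq> {1..n} \<and> card B = k}"
      by (rule finite_subset[of _ "Pow {1..n}"]) auto
  qed (use x in auto)
  also have "\<dots> \<le> x ^ \<Sum>{..k} * (\<Prod>i=1..n - k. 1 / (1 - x ^ i))"
    using x by (rule sum_pow_subsets_le)
  also have "\<dots> \<le> x ^ \<Sum>{..k} * exp (1 / (1 - x)\<^sup>2)"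
    using x by (intro mult_left_mono prod_inverse_one_minus_pow_le) auto
  finally show ?thesis using x by (simp add: field_simps)
qed

section \<open>Semigroups with Frobenius number below twice the multiplicity\<close>

definition depth2_gaps :: "nat \<Rightarrow> nat set \<Rightarrow> nat set" where
  "depth2_gaps p B = {1..p} \<union> (+) (Suc p) ` B"

lemma depth2_gaps_disjoint: "{1..p} \<inter> (+) (Suc p) ` B = {}"
  by auto

lemma card_depth2_gaps: "finite B \<Longrightarrow> card (depth2_gaps p B) = p + card B"
  unfolding depth2_gaps_def
  by (subst card_Un_disjoint[OF _ _ depth2_gaps_disjoint])
    (simp_all only: card_image[OF inj_on_add], simp_all)

lemma sum_depth2_gaps:
  "finite B \<Longrightarrow> \<Sum>(depth2_gaps p B) = \<Sum>{..p} + card B * Suc p + \<Sum>B"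
  unfolding depth2_gaps_def
  by (subst sum.union_disjoint[OF _ _ depth2_gaps_disjoint])
    (simp_all only: sum.reindex[OF inj_on_add],
     simp_all add: sum.distrib sum_Suc atMost_atLeast0 sum.atLeast_Suc_atMost[of 0])

text \<open>As 0 is not in \<open>B\<close>, \<open>Suc p\<close> is the least positive non-gap.
  This determines \<open>p\<close>, and then \<open>B\<close> is the upper block shifted
  back.\<close>

lemma depth2_gaps_inject:
  assumes "depth2_gaps p B = depth2_gaps q C" "B \<subseteq> {1..p}" "C \<subseteq> {1..q}"
  shows "p = q" "B = C"
proof -
  have *: "Suc p \<notin> depth2_gaps p B" "Suc q \<notin> depth2_gaps q C"
    using assms(2,3) by (auto simp: depth2_gaps_def)
  have initial: "i \<in> depth2_gaps n D" if "1 \<le> i" "i \<le> n" for i n D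
    using that by (simp add: depth2_gaps_def)
  show pq: "p = q"
  proof (rule ccontr)
    assume "p \<noteq> q"
    then consider "Suc p \<le> q" | "Suc q \<le> p" by linarith
    then show False
      using * assms(1) initial[of "Suc p" q C] initial[of "Suc q" p B] by cases auto
  qed
  have "(+) (Suc p) ` B = (+) (Suc p) ` C"
    using assms(1) depth2_gaps_disjoint[of p B] depth2_gaps_disjoint[of p C]
    unfolding pq depth2_gaps_def by blast
  then show "B = C" by (rule inj_image_eq_iff[OF inj_on_add, THEN iffD1])
qed

text \<open>Two nonzero elements are each at least p + 1, so their sum exceeds 2p + 1, the largest
  possible gap. Closure therefore puts no constraint on \<open>B\<close>.\<close>

lemma depth2_semigroup:
  assumes "B \<subseteq> {1..p}"
  shows "- depth2_gaps p B \<in> semigroups_of_genus (p + card B)"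
proof -
  let ?S = "- depth2_gaps p B"
  have fin: "finite B" using assms finite_subset by blast
  have g: "gaps ?S = depth2_gaps p B" by (simp add: gaps_def)
  have ub: "a \<le> 2 * p + 1" if "a \<in> depth2_gaps p B" for a
    using that assms by (auto simp: depth2_gaps_def)
  have "x + y \<in> ?S" if xy: "x \<in> ?S" "y \<in> ?S" for x y
  proof (cases "x = 0 \<or> y = 0")
    case False
    then have "Suc p \<le> x" "Suc p \<le> y" using xy by (auto simp: depth2_gaps_def)
    then have "\<not> x + y \<le> 2 * p + 1" by linarith
    then show ?thesis using ub by blast
  qed (use xy in auto)
  moreover have "0 \<in> ?S" by (auto simp: depth2_gaps_def)
  moreover have "finite (UNIV - ?S)"
    using fin g by (simp add: gaps_def depth2_gaps_def)
  ultimately show ?thesis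
    using fin by (simp add: semigroups_of_genus_def numerical_semigroup_def genus_def g card_depth2_gaps)
qed

lemma depth2_gapsE:
  assumes S: "numerical_semigroup S" and F: "frobenius_number S < 2 * semigroup_multiplicity S"
  obtains p B where "B \<subseteq> {1..p}" "S = - depth2_gaps p B"
proof -
  define m where "m = semigroup_multiplicity S"
  have fin: "finite (gaps S)" and z: "0 \<in> S"
    using S by (auto simp: numerical_semigroup_def gaps_def)
  \<comment> \<open>A nonzero element must exist before the \<open>LEAST\<close> defining the
    multiplicity says anything.\<close>
  have "infinite S" using fin finite_Diff2[of S UNIV] by (auto simp: gaps_def)
  then have "\<exists>n. n \<in> S \<and> n \<noteq> 0"
    by (metis finite.emptyI finite_insert finite_subset insertCI subsetI)
  then have m: "m \<in> S" "m \<noteq> 0"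
    unfolding m_def semigroup_multiplicity_def by (metis (mono_tags, lifting) LeastI)+
  have least: "n \<notin> S" if "n < m" "n \<noteq> 0" for n
    using not_less_Least[of n "\<lambda>n. n \<in> S \<and> n \<noteq> 0"] that
    by (auto simp: m_def semigroup_multiplicity_def)
  \<comment> \<open>For \<open>S = UNIV\<close> the Frobenius number is an unspecified
    \<open>Max {}\<close>, but then there is no such \<open>a\<close>.\<close>
  have large: "a < 2 * m" if "a \<notin> S" for a
    using Max_ge[OF fin, of a] that F by (simp add: frobenius_number_def m_def gaps_def)
  define p where "p = m - 1"
  have p: "Suc p = m" using m by (simp add: p_def)
  define B where "B = {b \<in> {1..p}. m + b \<notin> S}"
  have "- S = depth2_gaps p B"
  proof (intro equalityI subsetI)
    fix a assume "a \<in> - S"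
    then have a: "a \<notin> S" by simp
    then have "a \<noteq> 0" "a \<noteq> m" "a < 2 * m" using z m(1) large by metis+
    then consider "a \<in> {1..p}" | "a - m \<in> {1..p}" "a = m + (a - m)"
      unfolding p[symmetric] by (cases "a \<le> p") auto
    then show "a \<in> depth2_gaps p B"
    proof cases
      case 2
      then have "a - m \<in> B" using a by (simp add: B_def)
      then show ?thesis using 2 unfolding depth2_gaps_def p by blast
    qed (simp add: depth2_gaps_def)
  next
    fix a assume "a \<in> depth2_gaps p B"
    then show "a \<in> - S"
      unfolding depth2_gaps_def p using least p by (auto simp: B_def)
  qed
  then have "S = - depth2_gaps p B" by (metis double_complement)
  moreover have "B \<subseteq> {1..p}" unfolding B_def by (rule Collect_subset)
  ultimately show ?thesis using that by blast
qed

text \<open>With k = \<open>card B\<close>, the gap sum contains k(p + 1), while the triangular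
  number of p + k contributes only the cross term kp; the difference leaves k.\<close>

lemma weight_depth2:
  assumes "finite B"
  shows "weight (- depth2_gaps p B) = int (card B) + int (\<Sum>B) - int (\<Sum>{..card B})"
proof -
  define k where "k = card B"
  have T: "int n * (int n + 1) div 2 = int (\<Sum>{..n})" for n
    by (induction n) (simp_all add: algebra_simps)
  have "\<Sum>{..p + k} = \<Sum>{..p} + \<Sum>{..k} + k * p"
    by (induction k) auto
  moreover have "(\<Sum>a\<in>depth2_gaps p B. int a) = int (\<Sum>{..p} + k * Suc p + \<Sum>B)"
    using sum_depth2_gaps[OF assms, of p] by (simp only: k_def flip: of_nat_sum)
  ultimately show ?thesis
    using T[of "p + k"] assms
    by (simp add: weight_def genus_def gaps_def card_depth2_gaps k_def[symmetric] algebra_simps)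
qed

section \<open>Counting\<close>

text \<open>For each i \<le> a, one of i and a - i is a gap, since otherwise their sum a would lie
  in \<open>S\<close>. So the a + 1 numbers up to a are covered by the gaps and their
  reflections.\<close>

lemma gap_less_twice_genus:
  assumes S: "numerical_semigroup S" and a: "a \<in> gaps S"
  shows "a < 2 * genus S"
proof -
  have fin: "finite (gaps S)" using S by (simp add: numerical_semigroup_def gaps_def)
  have "{..a} \<subseteq> gaps S \<union> (-) a ` gaps S"
  proof
    fix i assume "i \<in> {..a}"
    then have i: "i + (a - i) = a" "i = a - (a - i)" by auto
    then have "i \<in> gaps S \<or> a - i \<in> gaps S"
      using S a by (metis DiffD2 DiffI UNIV_I gaps_def numerical_semigroup_def)
    then show "i \<in> gaps S \<union> (-) a ` gaps S" using i by blast
  qed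
  then have "card {..a} \<le> card (gaps S \<union> (-) a ` gaps S)"
    using fin by (intro card_mono) auto
  also have "\<dots> \<le> card (gaps S) + card ((-) a ` gaps S)" by (rule card_Un_le)
  also have "\<dots> \<le> 2 * genus S" using card_image_le[OF fin, of "(-) a"] by (simp add: genus_def)
  finally show ?thesis by simp
qed

text \<open>Since \<open>card\<close> is 0 on infinite sets, the lower bound on \<open>N g\<close>
  and the upper bound on its subsets rest on this.\<close>

lemma finite_semigroups_of_genus: "finite (semigroups_of_genus g)"
proof (rule finite_subset)
  show "semigroups_of_genus g \<subseteq> uminus ` Pow {..<2 * g}"
  proof
    fix S assume S: "S \<in> semigroups_of_genus g"
    have "- S \<subseteq> {..<2 * g}"
      using S gap_less_twice_genus[of S] by (auto simp: semigroups_of_genus_def gaps_def)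
    then have "- (- S) \<in> uminus ` Pow {..<2 * g}" by blast
    then show "S \<in> uminus ` Pow {..<2 * g}" by simp
  qed
  show "finite (uminus ` Pow {..<2 * g})" by simp
qed

text \<open>Taking p = g - k with \<open>card B = k\<close> fixes the genus at g. The choices of
  \<open>B\<close> number (g - k) choose k, and these sum along a diagonal of Pascal's triangle to a
  Fibonacci number.\<close>

lemma fib_le_N: "fib (Suc g) \<le> N g"
proof -
  let ?I = "SIGMA k:{..g}. {B. B \<subseteq> {1..g - k} \<and> card B = k}"
  let ?f = "\<lambda>(k, B). - depth2_gaps (g - k) B"
  have "inj_on ?f ?I"
  proof (rule inj_onI)
    fix u v assume uv: "u \<in> ?I" "v \<in> ?I" "?f u = ?f v"
    obtain k B l C where eq: "u = (k, B)" "v = (l, C)" by fastforce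
    then have BC: "B \<subseteq> {1..g - k}" "C \<subseteq> {1..g - l}" "card B = k" "card C = l"
      "depth2_gaps (g - k) B = depth2_gaps (g - l) C"
      using uv by auto
    then have "B = C" using depth2_gaps_inject(2) by blast
    then show "u = v" using BC eq by simp
  qed
  moreover have "?f ` ?I \<subseteq> semigroups_of_genus g"
  proof (rule image_subsetI)
    fix u assume "u \<in> ?I"
    then obtain k B where "u = (k, B)" "k \<le> g" "B \<subseteq> {1..g - k}" "card B = k" by auto
    then show "?f u \<in> semigroups_of_genus g"
      using depth2_semigroup[of B "g - k"] by simp
  qed
  ultimately have "card ?I \<le> N g"
    unfolding N_def using finite_semigroups_of_genus by (rule card_inj_on_le)
  moreover have "card ?I = (\<Sum>k\<le>g. (g - k) choose k)"
    by (simp add: n_subsets)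
  ultimately show ?thesis using ne_diagonal_fib[of g] by (simp add: atMost_atLeast0)
qed

text \<open>8/5 is a rational just below the golden ratio: (8/5)^2 = 64/25 \<le> 8/5 + 1. The factor
  5/8 gives equality at n = 1.\<close>

lemma fib_Suc_ge: "5 / 8 * (8 / 5) ^ n \<le> real (fib (Suc n))"
proof (induction n rule: fib.induct)
  case (3 n)
  have "5 / 8 * (8 / 5 :: real) ^ Suc (Suc n) = 64 / 25 * (5 / 8 * (8 / 5) ^ n)" by simp
  also have "\<dots> \<le> 5 / 8 * (8 / 5) ^ Suc n + 5 / 8 * (8 / 5) ^ n" by simp
  also have "\<dots> \<le> real (fib (Suc (Suc n))) + real (fib (Suc n))"
    using 3 by (intro add_mono)
  finally show ?case by simp
qed simp_all

lemma Q_le: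
  fixes x :: real
  assumes x: "0 < x" "x < 1"
  shows "real (Q g) \<le> real (Suc g) * (exp (1 / (1 - x)\<^sup>2) / x ^ g)"
proof -
  let ?X = "{S \<in> semigroups_of_genus g.
     frobenius_number S < 2 * semigroup_multiplicity S \<and> weight S < int g - 1}"
  let ?A = "\<lambda>p. {B. B \<subseteq> {1..p} \<and> card B = g - p \<and> \<Sum>B \<le> \<Sum>{..g - p} + g}"
  have finA: "finite (?A p)" for p by (rule finite_subset[of _ "Pow {1..p}"]) auto
  have "?X \<subseteq> (\<Union>p\<le>g. (\<lambda>B. - depth2_gaps p B) ` ?A p)"
  proof
    fix S assume S: "S \<in> ?X"
    then have "numerical_semigroup S" "frobenius_number S < 2 * semigroup_multiplicity S"
      by (simp_all add: semigroups_of_genus_def)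
    then obtain p B where B: "B \<subseteq> {1..p}" "S = - depth2_gaps p B"
      by (rule depth2_gapsE)
    have "finite B" using B finite_subset by blast
    then have "weight S = int (card B) + int (\<Sum>B) - int (\<Sum>{..card B})"
      using B weight_depth2 by simp
    moreover have "weight S < int g - 1" using S by simp
    \<comment> \<open>The weight condition bounds the excess by less than g - 1 -
      \<open>card B\<close>; it is relaxed to g to be uniform in \<open>card B\<close>.\<close>
    ultimately have "\<Sum>B \<le> \<Sum>{..card B} + g" by linarith
    moreover have "p + card B = g"
      using S depth2_semigroup[OF B(1)] B(2) by (simp add: semigroups_of_genus_def)
    ultimately have "B \<in> ?A p" "p \<le> g" using B by auto
    then show "S \<in> (\<Union>p\<le>g. (\<lambda>B. - depth2_gaps p B) ` ?A p)"
      using B by blast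
  qed
  then have "Q g \<le> card (\<Union>p\<le>g. (\<lambda>B. - depth2_gaps p B) ` ?A p)"
    unfolding Q_def using finA by (intro card_mono) auto
  also have "\<dots> \<le> (\<Sum>p\<le>g. card ((\<lambda>B. - depth2_gaps p B) ` ?A p))"
    by (rule card_UN_le) simp
  also have "\<dots> \<le> (\<Sum>p\<le>g. card (?A p))"
    using finA by (intro sum_mono card_image_le)
  finally have "real (Q g) \<le> (\<Sum>p\<le>g. real (card (?A p)))"
    by (simp only: of_nat_le_iff flip: of_nat_sum)
  also have "\<dots> \<le> (\<Sum>p\<le>g. exp (1 / (1 - x)\<^sup>2) / x ^ g)"
    using x by (intro sum_mono card_subsets_small_sum_le)
  finally show ?thesis by simp
qed

theorem proposition20:
  shows "(\<lambda>g. real (Q g) / real (N g)) \<longlonglongrightarrow> 0"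
proof (rule tendsto_sandwich[OF _ _ tendsto_const])
  \<comment> \<open>This is exp (1 / (1 - x)^2) at x = 2/3. The ratio 15/16 below is the growth rate
    3/2 of the bound on \<open>Q\<close> divided by the rate 8/5 of the bound on
    \<open>N\<close>.\<close>
  let ?C = "exp 9 :: real"
  have "real (Q g) / real (N g) \<le> 8 / 5 * ?C * (real (Suc g) * (15 / 16) ^ g)" for g
  proof -
    have "real (Q g) / real (N g) \<le> real (Suc g) * (?C / (2 / 3) ^ g) / (5 / 8 * (8 / 5) ^ g)"
    proof (rule frac_le)
      show "real (Q g) \<le> real (Suc g) * (?C / (2 / 3) ^ g)"
        using Q_le[of "2 / 3" g] by (simp add: power2_eq_square)
      show "5 / 8 * (8 / 5) ^ g \<le> real (N g)"
        using fib_Suc_ge[of g] fib_le_N[of g] by linarith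
    qed auto
    also have "\<dots> = 8 / 5 * ?C * (real (Suc g) * (1 / ((2 / 3) ^ g * (8 / 5) ^ g)))"
      by (simp add: mult_ac)
    also have "1 / ((2 / 3) ^ g * (8 / 5) ^ g) = (15 / 16 :: real) ^ g"
      by (simp add: power_mult_distrib[symmetric] power_one_over[symmetric])
    finally show ?thesis .
  qed
  then show "\<forall>\<^sub>F g in sequentially. real (Q g) / real (N g)
      \<le> 8 / 5 * ?C * (real (Suc g) * (15 / 16) ^ g)"
    by simp
  have "(\<lambda>g. real (Suc g) * (15 / 16) ^ g) \<longlonglongrightarrow> 0"
    by real_asymp
  then show "(\<lambda>g. 8 / 5 * ?C * (real (Suc g) * (15 / 16) ^ g)) \<longlonglongrightarrow> 0"
    by (rule tendsto_mult_right_zero)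
qed simp

end
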